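(* (I) Suppose $\limsup_{n\to\infty}\alpha_n/\beta_n<1$ and $\liminf_{n\to\infty}\beta_n>1$. Then there exist a real number $c$ with $0<c<1$ and a natural number $N$ such that $$|\Delta_n|<\{\alpha_0\}\,c^{\,n-N}\quad\text{and}\quad|\Delta_n'|<c^{\,n-N}\qquad\text{for all } n\ge N+3.$$ (II) If the sequence $\beta_n$ $(n\ge0)$ is bounded from above, then there exist $c$ and $N$ as in (I) (that is, a real $c$ with $0<c<1$ and a natural number $N$ for which the two inequalities displayed in (I) hold for all $n\ge N+3$) and a real number $a>0$ such that $$\left|\frac{p_n}{r_n}-\alpha_0\right|<\frac{\{\alpha_0\}\,c^{-N}}{r_n^{1+a}}\quad\text{and}\quad\left|\frac{q_n}{r_n}-\beta_0\right|<\frac{c^{-N}}{r_n^{1+a}}\qquad\text{for all } n\ge3.$$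
   Context: For real $x$ let $[x]$ be the greatest integer $\le x$ and $\{x\}=x-[x]$. Let $(\alpha_0,\beta_0)\in\mathbf{R}^2$ with $0\le\alpha_0\le\beta_0$, $1\le\beta_0$, and assume $1,\alpha_0,\beta_0$ are linearly independent over $\mathbf{Q}$. The Jacobi-Perron algorithm (dimension 2) defines, for $n\ge1$, $\alpha_n=\{\beta_{n-1}\}/\{\alpha_{n-1}\}$ and $\beta_n=1/\{\alpha_{n-1}\}$ (under the independence assumption all $\{\alpha_n\},\{\beta_n\}$ are nonzero, so this is defined for all $n$). Put $a_n=[\alpha_n]$, $b_n=[\beta_n]$ for $n\ge0$. Define $(r_{-2},r_{-1},r_0)=(0,0,1)$, $(p_{-2},p_{-1},p_0)=(1,0,a_0)$, $(q_{-2},q_{-1},q_0)=(0,1,b_0)$, and for $n\ge1$: $r_n=r_{n-1}b_n+r_{n-2}a_n+r_{n-3}$, $p_n=p_{n-1}b_n+p_{n-2}a_n+p_{n-3}$, $q_n=q_{n-1}b_n+q_{n-2}a_n+q_{n-3}$. Set $\Delta_n=p_n-\alpha_0 r_n$ and $\Delta_n'=q_n-\beta_0 r_n$ for $n\ge0$. *)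

theory Defs
  imports "HOL-Analysis.Analysis"
begin

text \<open>The complete quotients \<open>\<alpha>\<^sub>n\<close>, \<open>\<beta>\<^sub>n\<close> of the two-dimensional Jacobi-Perron algorithm
  started at \<open>(\<alpha>\<^sub>0, \<beta>\<^sub>0) = (x, y)\<close>.\<close>

fun jp_alpha :: "real \<Rightarrow> real \<Rightarrow> nat \<Rightarrow> real"
  and jp_beta :: "real \<Rightarrow> real \<Rightarrow> nat \<Rightarrow> real"
where
  "jp_alpha x y 0 = x"
| "jp_alpha x y (Suc n) = frac (jp_beta x y n) / frac (jp_alpha x y n)"
| "jp_beta x y 0 = y"
| "jp_beta x y (Suc n) = 1 / frac (jp_alpha x y n)"

definition jp_a :: "real \<Rightarrow> real \<Rightarrow> nat \<Rightarrow> int" where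
  "jp_a x y n = \<lfloor>jp_alpha x y n\<rfloor>"

definition jp_b :: "real \<Rightarrow> real \<Rightarrow> nat \<Rightarrow> int" where
  "jp_b x y n = \<lfloor>jp_beta x y n\<rfloor>"

text \<open>The argument of \<open>jp_rec\<close> is shifted by 2: \<open>jp_rec x y (u, v, w) k\<close> is the term with index
  \<open>k - 2\<close> of the solution of \<open>X\<^sub>n = X\<^sub>n\<^sub>-\<^sub>1 b\<^sub>n + X\<^sub>n\<^sub>-\<^sub>2 a\<^sub>n + X\<^sub>n\<^sub>-\<^sub>3\<close> (\<open>n \<ge> 1\<close>) with
  \<open>(X\<^sub>-\<^sub>2, X\<^sub>-\<^sub>1, X\<^sub>0) = (u, v, w)\<close>.\<close>

fun jp_rec :: "real \<Rightarrow> real \<Rightarrow> int \<times> int \<times> int \<Rightarrow> nat \<Rightarrow> int" where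
  "jp_rec x y (u, v, w) 0 = u"
| "jp_rec x y (u, v, w) (Suc 0) = v"
| "jp_rec x y (u, v, w) (Suc (Suc 0)) = w"
| "jp_rec x y (u, v, w) (Suc (Suc (Suc n))) =
     jp_rec x y (u, v, w) (Suc (Suc n)) * jp_b x y (Suc n)
     + jp_rec x y (u, v, w) (Suc n) * jp_a x y (Suc n)
     + jp_rec x y (u, v, w) n"

definition jp_r :: "real \<Rightarrow> real \<Rightarrow> nat \<Rightarrow> int" where
  "jp_r x y n = jp_rec x y (0, 0, 1) (n + 2)"

definition jp_p :: "real \<Rightarrow> real \<Rightarrow> nat \<Rightarrow> int" where
  "jp_p x y n = jp_rec x y (1, 0, jp_a x y 0) (n + 2)"

definition jp_q :: "real \<Rightarrow> real \<Rightarrow> nat \<Rightarrow> int" where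
  "jp_q x y n = jp_rec x y (0, 1, jp_b x y 0) (n + 2)"

definition jp_Delta :: "real \<Rightarrow> real \<Rightarrow> nat \<Rightarrow> real" where
  "jp_Delta x y n = of_int (jp_p x y n) - x * of_int (jp_r x y n)"

definition jp_Delta' :: "real \<Rightarrow> real \<Rightarrow> nat \<Rightarrow> real" where
  "jp_Delta' x y n = of_int (jp_q x y n) - y * of_int (jp_r x y n)"

text \<open>Linear independence over the rationals of \<open>1, x, y\<close> as a family; \<open>module.dependent\<close> only
  sees the set of its members, hence the distinctness condition.\<close>

definition jp_independent :: "real \<Rightarrow> real \<Rightarrow> bool" where
  "jp_independent x y \<longleftrightarrow>
     distinct [1, x, y] \<and> \<not> module.dependent (\<lambda>(c::rat) (v::real). of_rat c * v) {1, x, y}"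

end

theory Submission
  imports Defs
begin

text \<open>Index a sequence of errors \<open>\<Delta>\<close> as in the informal definition and write \<open>{z}\<close> for the fractional
  part of \<open>z\<close>. The errors satisfy two recurrences, the integral one of the convergents
  \<open>\<Delta>\<^sub>n = b\<^sub>n \<Delta>\<^sub>n\<^sub>-\<^sub>1 + a\<^sub>n \<Delta>\<^sub>n\<^sub>-\<^sub>2 + \<Delta>\<^sub>n\<^sub>-\<^sub>3\<close>
  and the fractional one
  \<open>\<Delta>\<^sub>n = - {\<beta>\<^sub>n} \<Delta>\<^sub>n\<^sub>-\<^sub>1 - {\<alpha>\<^sub>n} \<Delta>\<^sub>n\<^sub>-\<^sub>2\<close>.
  The second holds because \<open>\<beta>\<^sub>n X\<^sub>n\<^sub>-\<^sub>1 + \<alpha>\<^sub>n X\<^sub>n\<^sub>-\<^sub>2 + X\<^sub>n\<^sub>-\<^sub>3\<close> is only rescaled along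
  solutions \<open>X\<close> of the first, and vanishes for the errors at \<open>n = 0\<close>.
  Neither recurrence alone makes \<open>\<Delta>\<^sub>n\<close> decrease: the coefficients of the first are large, and
  those of the second can add up to more than 1. Their signs, however, complement each other.
  If all fractional parts are at most \<open>1 - e\<close>, the two together show that \<open>\<bar>\<Delta>\<^sub>n\<bar>\<close> is at most
  \<open>1 - e / 2\<close> times the largest of the three previous absolute values
  (\<open>max3_contraction\<close>), so the errors decay exponentially (\<open>Delta_decay\<close>).

  The hypotheses of both parts provide such an \<open>e\<close>. Since \<open>{\<beta>\<^sub>n}\<close> is the quotient
  \<open>\<alpha>\<^sub>n\<^sub>+\<^sub>1 / \<beta>\<^sub>n\<^sub>+\<^sub>1\<close> and \<open>{\<alpha>\<^sub>n} = 1 / \<beta>\<^sub>n\<^sub>+\<^sub>1\<close>, the conditions on the upper and lower limits say just that,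
  for all large \<open>n\<close>. If \<open>\<beta>\<^sub>n \<le> B\<close> for all \<open>n\<close>, the fractional parts are bounded below, and this
  in turn bounds them away from 1 (\<open>bounded_frac_gap\<close>). In that case \<open>r\<^sub>n\<close> moreover grows at
  most like \<open>K\<^sup>n\<close>. With \<open>K\<^sup>a = 1 / c\<close> the factor \<open>r\<^sub>n\<^sup>a\<close> is then absorbed by the decay \<open>c\<^sup>n\<close>
  of the errors, which yields the rate of approximation by \<open>p\<^sub>n / r\<^sub>n\<close> and \<open>q\<^sub>n / r\<^sub>n\<close>.\<close>

section \<open>Exponential decay from a contracting three-term maximum\<close>

text \<open>The oldest term on the right is three steps back, so a loss of \<open>c ^ 3\<close> per use is a loss of
  \<open>c\<close> per step. The constant absorbs the finitely many terms before the contraction sets in.\<close>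

lemma exp_decay_of_max3_contraction:
  fixes d :: "nat \<Rightarrow> real"
  assumes "0 < c" "c < 1"
    and step: "\<And>n. n \<ge> n0 \<Longrightarrow> d (n + 3) \<le> c ^ 3 * max (d n) (max (d (n + 1)) (d (n + 2)))"
  shows "\<exists>C. \<forall>n. d n \<le> C * c ^ n"
proof -
  define C where "C = Max (insert 0 ((\<lambda>n. d n / c ^ n) ` {..<n0 + 3}))"
  have "0 \<le> C" unfolding C_def by (rule Max_ge) auto
  have "d n \<le> C * c ^ n" for n
  proof (induction n rule: less_induct)
    case (less n)
    show ?case
    proof (cases "n < n0 + 3")
      case True
      then have "d n / c ^ n \<le> C" unfolding C_def by (intro Max_ge) auto
      with \<open>0 < c\<close> show ?thesis by (simp add: field_simps)
    next
      case False
      define m where "m = n - 3"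
      have m: "n = m + 3" "n0 \<le> m" using False by (auto simp: m_def)
      have pw: "c ^ (m + j) \<le> c ^ m" for j
        using assms by (intro power_decreasing) auto
      have old: "d (m + j) \<le> C * c ^ m" if "j < 3" for j
      proof -
        have "d (m + j) \<le> C * c ^ (m + j)" using less[of "m + j"] that m by simp
        also have "\<dots> \<le> C * c ^ m" using pw \<open>0 \<le> C\<close> by (intro mult_left_mono)
        finally show ?thesis .
      qed
      have "d n \<le> c ^ 3 * max (d m) (max (d (m + 1)) (d (m + 2)))"
        using step m by simp
      also have "\<dots> \<le> c ^ 3 * (C * c ^ m)"
        using old[of 0] old[of 1] old[of 2] \<open>0 < c\<close> by (intro mult_left_mono) auto
      finally show ?thesis using m by (simp add: power_add mult_ac)
    qed
  qed
  then show ?thesis by blast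
qed

text \<open>If \<open>x1\<close> and \<open>x2\<close> have opposite signs, the two terms of \<open>- u * x2 - v * x1\<close> partly
  cancel, and \<open>x3\<close> is at most \<open>1 - e\<close> times the larger of them. If they have the same sign,
  that recurrence gives only \<open>\<bar>x3\<bar> \<le> \<bar>x2\<bar> + (1 - e) * \<bar>x1\<bar>\<close>. But it also shows that \<open>x3\<close> has the
  opposite sign. In the integral recurrence \<open>x0\<close> must therefore outweigh both \<open>b * x2\<close> and
  \<open>a * x1\<close>, so \<open>\<bar>x3\<bar> \<le> \<bar>x0\<bar> - \<bar>x2\<bar>\<close>. The average of the two bounds is free of \<open>\<bar>x2\<bar>\<close> and gives
  the factor \<open>1 - e / 2\<close>.\<close>

lemma max3_contraction:
  fixes x0 x1 x2 x3 :: real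
  assumes int_rec: "x3 = b * x2 + a * x1 + x0" and "1 \<le> b" "0 \<le> a"
    and frac_rec: "x3 = - u * x2 - v * x1"
    and "0 \<le> u" "0 \<le> v" "u \<le> 1 - e" "v \<le> 1 - e" "0 \<le> e"
  shows "\<bar>x3\<bar> \<le> (1 - e / 2) * max \<bar>x0\<bar> (max \<bar>x1\<bar> \<bar>x2\<bar>)"
proof -
  define M where "M = max \<bar>x0\<bar> (max \<bar>x1\<bar> \<bar>x2\<bar>)"
  have M: "\<bar>x0\<bar> \<le> M" "\<bar>x1\<bar> \<le> M" "\<bar>x2\<bar> \<le> M" "0 \<le> M" unfolding M_def by auto
  define S where "S = u * x2"
  define T where "T = v * x1"
  define W where "W = (1 - e) * M"
  have x3: "x3 = - S - T" using frac_rec by (simp add: S_def T_def)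
  have "\<bar>S\<bar> \<le> W" "\<bar>T\<bar> \<le> W"
    unfolding abs_mult S_def T_def W_def using assms M by (auto intro!: mult_mono)
  then have S: "S \<le> W" "- S \<le> W" and T: "T \<le> W" "- T \<le> W"
    unfolding abs_le_iff by blast+
  have bound: "(1 - e / 2) * M = M / 2 + W / 2"
    by (simp add: W_def algebra_simps add_divide_distrib diff_divide_distrib)
  have "W \<le> M" using mult_nonneg_nonneg[OF \<open>0 \<le> e\<close> \<open>0 \<le> M\<close>] by (simp add: W_def algebra_simps)
  have "u \<le> 1" using assms by simp
  consider "x1 \<ge> 0" "x2 \<le> 0" | "x1 \<le> 0" "x2 \<ge> 0" | "x1 > 0" "x2 > 0" | "x1 < 0" "x2 < 0"
    by linarith
  then have "\<bar>x3\<bar> \<le> M / 2 + W / 2"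
  proof cases
    case 1
    then have "0 \<le> T" "S \<le> 0" using assms by (auto simp: mult_nonneg_nonpos S_def T_def)
    with x3 S T \<open>W \<le> M\<close> show ?thesis unfolding abs_le_iff by simp
  next
    case 2
    then have "T \<le> 0" "0 \<le> S" using assms by (auto simp: mult_nonneg_nonpos S_def T_def)
    with x3 S T \<open>W \<le> M\<close> show ?thesis unfolding abs_le_iff by simp
  next
    case 3
    have ST: "0 \<le> T" "0 \<le> S" "S \<le> x2"
      using 3 assms \<open>u \<le> 1\<close> by (auto simp: S_def T_def mult_left_le_one_le)
    have "x2 \<le> b * x2" "0 \<le> a * x1" using 3 assms(2,3) by simp_all
    then have "x0 + x2 \<le> x3" unfolding int_rec by simp
    then show ?thesis using ST x3 T M unfolding abs_le_iff by simp
  next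
    case 4
    have ST: "T \<le> 0" "S \<le> 0" "x2 \<le> S"
      using 4 assms mult_right_mono_neg[OF \<open>u \<le> 1\<close>, of x2]
      by (auto simp: S_def T_def mult_nonneg_nonpos)
    have "b * x2 \<le> x2" "a * x1 \<le> 0"
      using 4 assms(2,3) mult_right_mono_neg[OF \<open>1 \<le> b\<close>, of x2]
      by (auto simp: mult_nonneg_nonpos)
    then have "x3 \<le> x0 + x2" unfolding int_rec by simp
    then show ?thesis using ST x3 T M unfolding abs_le_iff by simp
  qed
  then show ?thesis using bound unfolding M_def by simp
qed

section \<open>The complete quotients\<close>

text \<open>Independence is used with integer coefficients, in which form one step of the algorithm
  transports it.\<close>

definition int_independent :: "real \<Rightarrow> real \<Rightarrow> bool" where
  "int_independent x y \<longleftrightarrow>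
     (\<forall>k l m :: int. of_int k + of_int l * x + of_int m * y = 0 \<longrightarrow> k = 0 \<and> l = 0 \<and> m = 0)"

lemma jp_independent_imp_int_independent:
  assumes "jp_independent x y"
  shows "int_independent x y"
  unfolding int_independent_def
proof (intro allI impI)
  fix k l m :: int
  assume rel: "of_int k + of_int l * x + of_int m * y = 0"
  interpret Q: module "\<lambda>(c::rat) (v::real). of_rat c * v"
    by unfold_locales (auto simp: algebra_simps of_rat_add of_rat_mult)
  have dist: "1 \<noteq> x" "1 \<noteq> y" "x \<noteq> y" and indep: "\<not> Q.dependent {1, x, y}"
    using assms by (auto simp: jp_independent_def)
  define w :: "real \<Rightarrow> rat" where
    "w = (\<lambda>v. if v = 1 then of_int k else if v = x then of_int l else of_int m)"
  have "(\<Sum>v\<in>{1, x, y}. of_rat (w v) * v) = 0"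
    using rel dist by (auto simp: w_def algebra_simps)
  then have "Q.dependent {1, x, y}" if "\<exists>v\<in>{1, x, y}. w v \<noteq> 0"
    using that Q.dependent_finite[of "{1, x, y}"] by (simp only: finite.intros) blast
  with indep have "w 1 = 0" "w x = 0" "w y = 0" by auto
  with dist show "k = 0 \<and> l = 0 \<and> m = 0"
    by (auto simp: w_def split: if_splits)
qed

lemma int_independent_frac_pos:
  assumes "int_independent x y"
  shows "0 < frac x"
proof -
  have "x \<noteq> of_int \<lfloor>x\<rfloor>"
    using assms[unfolded int_independent_def, rule_format, of "- \<lfloor>x\<rfloor>" 1 0] by auto
  then show ?thesis
    unfolding frac_def using of_int_floor_le[of x] by linarith
qed

lemma int_independent_step:
  assumes "int_independent x y"
  shows "int_independent (frac y / frac x) (1 / frac x)"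
  unfolding int_independent_def
proof (intro allI impI)
  fix k l m :: int
  assume rel: "of_int k + of_int l * (frac y / frac x) + of_int m * (1 / frac x) = 0"
  have "of_int k * frac x + of_int l * frac y + of_int m = 0"
    using rel int_independent_frac_pos[OF assms] by (simp add: field_simps)
  then have "of_int (m - k * \<lfloor>x\<rfloor> - l * \<lfloor>y\<rfloor>) + of_int k * x + of_int l * y = 0"
    by (simp add: frac_def algebra_simps)
  with assms have "m - k * \<lfloor>x\<rfloor> - l * \<lfloor>y\<rfloor> = 0 \<and> k = 0 \<and> l = 0"
    unfolding int_independent_def by blast
  then show "k = 0 \<and> l = 0 \<and> m = 0" by auto
qed

locale jacobi_perron =
  fixes x y :: real
  assumes x_nonneg: "0 \<le> x" and y_ge_1: "1 \<le> y" and x_le_y: "x \<le> y"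
    and indep: "int_independent x y"
begin

abbreviation "al \<equiv> jp_alpha x y"
abbreviation "be \<equiv> jp_beta x y"

lemma int_independent_quotients: "int_independent (al n) (be n)"
  by (induction n) (auto intro: indep int_independent_step)

lemma frac_al_pos: "0 < frac (al n)"
  by (rule int_independent_frac_pos[OF int_independent_quotients])

lemma al_nonneg: "0 \<le> al n"
  by (cases n) (auto simp: x_nonneg)

lemma be_ge_1: "1 \<le> be n"
proof (cases n)
  case (Suc m)
  then show ?thesis using frac_al_pos[of m] frac_lt_1[of "al m"] by (simp only: jp_beta.simps) simp
qed (simp add: y_ge_1)

lemma al_le_be: "al n \<le> be n"
proof (cases n)
  case (Suc m)
  then show ?thesis
    using frac_al_pos[of m] frac_lt_1[of "be m"]
    by (simp only: jp_alpha.simps jp_beta.simps divide_right_mono less_imp_le)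
qed (simp add: x_le_y)

lemma a_nonneg: "0 \<le> jp_a x y n" and b_ge_1: "1 \<le> jp_b x y n"
  using al_nonneg be_ge_1 by (auto simp: jp_a_def jp_b_def)

lemma frac_al_eq: "frac (al n) = 1 / be (Suc n)"
  using frac_al_pos[of n] by simp

lemma frac_be_eq: "frac (be n) = al (Suc n) / be (Suc n)"
  using frac_al_pos[of n] by simp

declare jp_alpha.simps(2) [simp del] jp_beta.simps(2) [simp del]

section \<open>The approximation errors\<close>

text \<open>The argument is shifted by 2, as in \<^const>\<open>jp_rec\<close>. The integral recurrence has a
  three-dimensional space of solutions; the linear condition on the initial values selects the
  plane spanned by the errors of the two approximations.\<close>

definition error_solution :: "(nat \<Rightarrow> real) \<Rightarrow> bool" where
  "error_solution X \<longleftrightarrow>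
     (\<forall>n. X (n + 3) = of_int (jp_b x y (Suc n)) * X (n + 2)
        + of_int (jp_a x y (Suc n)) * X (n + 1) + X n) \<and>
     X 2 + frac (be 0) * X 1 + frac (al 0) * X 0 = 0"

text \<open>For every solution of the integral recurrence,
  \<open>X (n + 2) + frac (be n) * X (n + 1) + frac (al n) * X n\<close> is multiplied by \<open>be (Suc n)\<close> when
  \<open>n\<close> increases by 1, so it stays zero if it starts at zero.\<close>

lemma error_solution_two_term:
  assumes "error_solution X"
  shows "X (n + 2) = - frac (be n) * X (n + 1) - frac (al n) * X n"
proof (induction n)
  case 0
  then show ?case using assms by (simp add: error_solution_def numeral_2_eq_2)
next
  case (Suc n)
  let ?A = "al (Suc n)" and ?B = "be (Suc n)"
  have B: "?B \<noteq> 0" using be_ge_1[of "Suc n"] by linarith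
  have "X (n + 3) + frac ?B * X (n + 2) + frac ?A * X (n + 1)
      = ?B * X (n + 2) + ?A * X (n + 1) + X n"
    using assms by (simp add: error_solution_def frac_def jp_a_def jp_b_def algebra_simps)
  also have "\<dots> = ?B * (X (n + 2) + frac (be n) * X (n + 1) + frac (al n) * X n)"
    using B unfolding frac_al_eq[of n] frac_be_eq[of n] by (simp add: field_simps)
  also have "\<dots> = 0" using Suc by simp
  finally have "X (n + 3) = - frac ?B * X (n + 2) - frac ?A * X (n + 1)" by linarith
  then show ?case by (simp add: eval_nat_numeral)
qed

lemma error_solution_decay:
  assumes X: "error_solution X" and e: "0 < e" "e \<le> 1"
    and small: "\<And>n. n \<ge> n0 \<Longrightarrow> frac (al n) \<le> 1 - e \<and> frac (be n) \<le> 1 - e"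
  shows "\<exists>C. \<forall>n. \<bar>X n\<bar> \<le> C * root 3 (1 - e / 2) ^ n"
proof (rule exp_decay_of_max3_contraction[where ?n0.0 = n0])
  fix n assume n: "n \<ge> n0"
  have "\<bar>X (n + 3)\<bar> \<le> (1 - e / 2) * max \<bar>X n\<bar> (max \<bar>X (n + 1)\<bar> \<bar>X (n + 2)\<bar>)"
  proof (rule max3_contraction)
    show "X (n + 3) = of_int (jp_b x y (Suc n)) * X (n + 2)
        + of_int (jp_a x y (Suc n)) * X (n + 1) + X n"
      using X by (simp add: error_solution_def)
    show "X (n + 3) = - frac (be (n + 1)) * X (n + 2) - frac (al (n + 1)) * X (n + 1)"
      using error_solution_two_term[OF X, of "n + 1"] by (simp add: numeral_eq_Suc)
  qed (use a_nonneg b_ge_1 small[of "n + 1"] n e frac_ge_0 in auto)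
  then show "\<bar>X (n + 3)\<bar> \<le> root 3 (1 - e / 2) ^ 3 * max \<bar>X n\<bar> (max \<bar>X (n + 1)\<bar> \<bar>X (n + 2)\<bar>)"
    using e by simp
qed (use e in auto)

text \<open>The bounds hold from \<open>n = 0\<close> on, with \<open>c ^ n / c ^ N > 1\<close> for \<open>n < N\<close>. This makes the constant
  \<open>1 / c ^ N\<close> serve for the convergents of all indices. The factor \<open>frac x < 1\<close> is fixed, hence
  paid for by the choice of \<open>N\<close>.\<close>

lemma Delta_decay:
  assumes e: "0 < e" "e \<le> 1"
    and small: "\<forall>\<^sub>F n in sequentially. frac (al n) \<le> 1 - e \<and> frac (be n) \<le> 1 - e"
  obtains c N where "0 < c" "c < 1"
    "\<And>n. \<bar>jp_Delta x y n\<bar> < frac x * (c ^ n / c ^ N)"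
    "\<And>n. \<bar>jp_Delta' x y n\<bar> < c ^ n / c ^ N"
proof -
  define c where "c = root 3 (1 - e / 2)"
  have c: "0 < c" "c < 1" using e by (auto simp: c_def)
  obtain n0 where n0: "\<And>n. n \<ge> n0 \<Longrightarrow> frac (al n) \<le> 1 - e \<and> frac (be n) \<le> 1 - e"
    using small unfolding eventually_sequentially by blast
  define P where "P = (\<lambda>n. of_int (jp_rec x y (1, 0, jp_a x y 0) n)
    - x * of_int (jp_rec x y (0, 0, 1) n))"
  define Q where "Q = (\<lambda>n. of_int (jp_rec x y (0, 1, jp_b x y 0) n)
    - y * of_int (jp_rec x y (0, 0, 1) n))"
  have "error_solution P" "error_solution Q"
    unfolding error_solution_def P_def Q_def
    by (auto simp: numeral_eq_Suc jp_a_def jp_b_def frac_def algebra_simps)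
  then have "\<exists>C. \<forall>n. \<bar>P n\<bar> \<le> C * c ^ n" "\<exists>D. \<forall>n. \<bar>Q n\<bar> \<le> D * c ^ n"
    unfolding c_def by (auto intro: error_solution_decay[OF _ e n0])
  then obtain C D where CD: "\<And>n. \<bar>P n\<bar> \<le> C * c ^ n" "\<And>n. \<bar>Q n\<bar> \<le> D * c ^ n"
    by blast
  (* Replacing the shifted index n + 2 by n costs nothing, since powers of c decrease. *)
  define E where "E = max 1 (max C D)"
  have E: "\<bar>P (n + 2)\<bar> \<le> E * c ^ n" "\<bar>Q (n + 2)\<bar> \<le> E * c ^ n" for n
  proof -
    have "C \<le> E" "D \<le> E" "0 \<le> E" by (auto simp: E_def)
    then have "C * c ^ (n + 2) \<le> E * c ^ n" "D * c ^ (n + 2) \<le> E * c ^ n"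
      using c by (intro mult_mono power_decreasing; simp)+
    with CD[of "n + 2"] show "\<bar>P (n + 2)\<bar> \<le> E * c ^ n" "\<bar>Q (n + 2)\<bar> \<le> E * c ^ n"
      by linarith+
  qed
  have fx: "0 < frac x" "frac x < 1" using frac_al_pos[of 0] frac_lt_1 by auto
  have "E > 0" by (auto simp: E_def)
  then obtain N where "c ^ N < frac x / E"
    using real_arch_pow_inv[of "frac x / E" c] c fx by auto
  then have N: "E < frac x / c ^ N" using \<open>E > 0\<close> c by (simp add: field_simps)
  have "E * c ^ n < frac x * (c ^ n / c ^ N)" for n
    using mult_strict_right_mono[OF N, of "c ^ n"] c by simp
  moreover have "frac x * (c ^ n / c ^ N) \<le> c ^ n / c ^ N" for n
    using fx c by (intro mult_left_le_one_le) auto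
  ultimately have "\<bar>P (n + 2)\<bar> < frac x * (c ^ n / c ^ N)" "\<bar>Q (n + 2)\<bar> < c ^ n / c ^ N" for n
    using E[of n] by (smt (verit))+
  moreover have "jp_Delta x y n = P (n + 2)" "jp_Delta' x y n = Q (n + 2)" for n
    by (auto simp: jp_Delta_def jp_Delta'_def jp_p_def jp_q_def jp_r_def P_def Q_def)
  ultimately show ?thesis using that[OF c, of N] by presburger
qed

section \<open>Bounded quotients\<close>

text \<open>Under the bound all fractional parts are at least \<open>1 / B\<^sup>2\<close>, which keeps \<open>be n\<close> away from 1.
  The distance of \<open>al n\<close> from \<open>be n\<close> is the delicate point. If their integer parts differ, then
  \<open>be n - al n > frac (be n)\<close>. If they agree, then
  \<open>be n - al n = (al (Suc n) - 1) / be (Suc n)\<close>. As this is positive, \<open>al (Suc n) > 1\<close>, and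
  \<open>al (Suc n)\<close> exceeds 1 at least by its fractional part.\<close>

lemma bounded_frac_gap:
  assumes B: "\<And>n. be n \<le> B"
  shows "frac (al n) \<le> 1 - 1 / B ^ 3" "frac (be n) \<le> 1 - 1 / B ^ 3"
proof -
  have B1: "1 \<le> B" using B[of 0] be_ge_1[of 0] by linarith
  have fal: "1 / B \<le> frac (al n)" for n
    unfolding frac_al_eq using B[of "Suc n"] be_ge_1[of "Suc n"] by (intro divide_left_mono) auto
  have quot: "1 / B ^ 2 \<le> t / be n" if "1 / B \<le> t" for t n
  proof -
    have "1 / B ^ 2 = (1 / B) / B" by (simp add: power2_eq_square)
    also have "\<dots> \<le> t / be n"
      using B1 B[of n] be_ge_1[of n] that by (intro frac_le) (auto intro: order_trans[of _ "1 / B"])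
    finally show ?thesis .
  qed
  have fbe: "1 / B ^ 2 \<le> frac (be n)" for n
  proof -
    have "1 / B \<le> al (Suc n)"
      using fal[of "Suc n"] a_nonneg[of "Suc n"] unfolding frac_def jp_a_def by linarith
    then show ?thesis unfolding frac_be_eq by (rule quot)
  qed
  have gap: "1 / B ^ 2 \<le> be (Suc n) - al (Suc n)" for n
  proof -
    let ?A = "al (Suc n)" and ?C = "be (Suc n)"
    have fl: "\<lfloor>?A\<rfloor> \<le> \<lfloor>?C\<rfloor>" using al_le_be by (intro floor_mono)
    show ?thesis
    proof (cases "\<lfloor>?A\<rfloor> = \<lfloor>?C\<rfloor>")
      case True
      let ?A' = "al (Suc (Suc n))" and ?C' = "be (Suc (Suc n))"
      have C': "0 < ?C'" using be_ge_1[of "Suc (Suc n)"] by linarith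
      have eq: "?C - ?A = (?A' - 1) / ?C'"
        using True frac_al_eq[of "Suc n"] frac_be_eq[of "Suc n"]
        by (simp add: frac_def diff_divide_distrib)
      have "?A \<noteq> ?C"
        using int_independent_quotients[of "Suc n", unfolded int_independent_def,
            rule_format, of 0 1 "-1"] by auto
      with al_le_be[of "Suc n"] have "?A < ?C" by linarith
      with eq C' have "1 < ?A'" by (smt (verit) divide_nonpos_pos)
      then have "1 \<le> \<lfloor>?A'\<rfloor>" by linarith
      then have "1 / B \<le> ?A' - 1"
        using fal[of "Suc (Suc n)"] unfolding frac_def by linarith
      then show ?thesis unfolding eq by (rule quot)
    next
      case False
      with fl have "real_of_int \<lfloor>?C\<rfloor> \<ge> of_int \<lfloor>?A\<rfloor> + 1" by linarith
      then show ?thesis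
        using fbe[of "Suc n"] frac_lt_1[of ?A] by (simp add: frac_def)
    qed
  qed
  have cube: "1 / B ^ 3 \<le> t / be (Suc n)" if "1 / B ^ 2 \<le> t" for t
  proof -
    have "1 / B ^ 3 = (1 / B ^ 2) / B" by (simp add: power3_eq_cube power2_eq_square)
    also have "\<dots> \<le> t / be (Suc n)"
      using B1 B[of "Suc n"] be_ge_1[of "Suc n"] that
      by (intro frac_le) (auto intro: order_trans[of _ "1 / B ^ 2"])
    finally show ?thesis .
  qed
  have C: "0 < be (Suc n)" using be_ge_1[of "Suc n"] by linarith
  have "1 / B ^ 2 \<le> be (Suc n) - 1"
    using fbe[of "Suc n"] b_ge_1[of "Suc n"] unfolding frac_def jp_b_def by linarith
  from cube[OF this] show "frac (al n) \<le> 1 - 1 / B ^ 3"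
    unfolding frac_al_eq using C by (simp add: diff_divide_distrib)
  from cube[OF gap[of n]] show "frac (be n) \<le> 1 - 1 / B ^ 3"
    unfolding frac_be_eq using C by (simp add: diff_divide_distrib)
qed

lemma rec_r_bounds:
  "0 \<le> jp_rec x y (0, 0, 1) n \<and> 0 \<le> jp_rec x y (0, 0, 1) (n + 1)
      \<and> 1 \<le> jp_rec x y (0, 0, 1) (n + 2)"
proof (induction n)
  case (Suc n)
  then have "1 * 1 \<le> jp_rec x y (0, 0, 1) (n + 2) * jp_b x y (Suc n)"
    using b_ge_1 by (intro mult_mono) auto
  moreover have "0 \<le> jp_rec x y (0, 0, 1) (n + 1) * jp_a x y (Suc n)"
    using Suc a_nonneg by simp
  ultimately show ?case using Suc by simp
qed simp

lemma r_ge_1: "1 \<le> jp_r x y n"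
  using rec_r_bounds[of n] by (simp add: jp_r_def)

lemma r_growth:
  assumes B: "\<And>n. be n \<le> B"
  shows "of_int (jp_r x y n) \<le> (2 * B + 1) ^ n"
proof -
  define K where "K = 2 * B + 1"
  define R where "R n = real_of_int (jp_rec x y (0, 0, 1) n)" for n
  have B1: "1 \<le> B" using B[of 0] be_ge_1[of 0] by linarith
  have K: "1 \<le> K" using B1 by (simp add: K_def)
  have ab: "of_int (jp_a x y n) \<le> B" "of_int (jp_b x y n) \<le> B" for n
    using B[of n] al_le_be[of n] by (simp_all add: jp_a_def jp_b_def) linarith+
  have R0: "0 \<le> R n" for n
    using rec_r_bounds[of n] by (simp add: R_def)
  (* R is shifted by 2; its initial values 0, 0, 1 satisfy the shifted bound. *)
  have "R n * K ^ 2 \<le> K ^ n" for n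
  proof (induction n rule: less_induct)
    case (less n)
    consider "n = 0" | "n = 1" | "n = 2" | "3 \<le> n" by linarith
    then show ?case
    proof cases
      case 4
      define m where "m = n - 3"
      have m: "n = m + 3" using 4 by (simp add: m_def)
      have old: "R (m + j) * K ^ 2 \<le> K ^ (m + 2)" if "j < 3" for j
        using less[of "m + j"] m that power_increasing[of "m + j" "m + 2" K] K by simp
      have "R n = of_int (jp_b x y (Suc m)) * R (m + 2) + of_int (jp_a x y (Suc m)) * R (m + 1) + R m"
        unfolding m by (simp add: R_def numeral_eq_Suc)
      also have "\<dots> \<le> B * R (m + 2) + B * R (m + 1) + R m"
        using ab R0 by (intro add_mono mult_right_mono) auto
      finally have "R n * K ^ 2 \<le> (B * R (m + 2) + B * R (m + 1) + R m) * K ^ 2"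
        by (intro mult_right_mono) auto
      also have "\<dots> = B * (R (m + 2) * K ^ 2) + B * (R (m + 1) * K ^ 2) + R m * K ^ 2"
        by (simp add: algebra_simps)
      also have "\<dots> \<le> B * K ^ (m + 2) + B * K ^ (m + 2) + K ^ (m + 2)"
        using old[of 0] old[of 1] old[of 2] B1 by (intro add_mono mult_left_mono) auto
      also have "\<dots> = K * K ^ (m + 2)" by (simp add: K_def algebra_simps)
      finally show ?thesis using m by (simp add: numeral_eq_Suc)
    qed (use K in \<open>auto simp: R_def numeral_2_eq_2\<close>)
  qed
  from this[of "n + 2"] have "R (n + 2) * K ^ 2 \<le> K ^ n * K ^ 2" by (simp only: power_add)
  then have "R (n + 2) \<le> K ^ n" using K by simp
  then show ?thesis by (simp add: R_def K_def jp_r_def)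
qed

end

section \<open>Rates of convergence\<close>

theorem theorem2p3:
  fixes \<alpha>0 \<beta>0 :: real
  assumes "0 \<le> \<alpha>0" and "\<alpha>0 \<le> \<beta>0" and "1 \<le> \<beta>0"
    and "jp_independent \<alpha>0 \<beta>0"
  shows
    "(limsup (\<lambda>n. ereal (jp_alpha \<alpha>0 \<beta>0 n / jp_beta \<alpha>0 \<beta>0 n)) < 1 \<and>
      liminf (\<lambda>n. ereal (jp_beta \<alpha>0 \<beta>0 n)) > 1 \<longrightarrow>
        (\<exists>(c::real) (N::nat). 0 < c \<and> c < 1 \<and>
          (\<forall>n\<ge>N + 3. \<bar>jp_Delta \<alpha>0 \<beta>0 n\<bar> < frac \<alpha>0 * c ^ (n - N) \<and>
                      \<bar>jp_Delta' \<alpha>0 \<beta>0 n\<bar> < c ^ (n - N)))) \<and>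
     (bdd_above (range (jp_beta \<alpha>0 \<beta>0)) \<longrightarrow>
        (\<exists>(c::real) (N::nat) (a::real). 0 < c \<and> c < 1 \<and> 0 < a \<and>
          (\<forall>n\<ge>N + 3. \<bar>jp_Delta \<alpha>0 \<beta>0 n\<bar> < frac \<alpha>0 * c ^ (n - N) \<and>
                      \<bar>jp_Delta' \<alpha>0 \<beta>0 n\<bar> < c ^ (n - N)) \<and>
          (\<forall>n\<ge>3. \<bar>of_int (jp_p \<alpha>0 \<beta>0 n) / of_int (jp_r \<alpha>0 \<beta>0 n) - \<alpha>0\<bar>
                    < frac \<alpha>0 * c powi (- int N) / of_int (jp_r \<alpha>0 \<beta>0 n) powr (1 + a) \<and>
                  \<bar>of_int (jp_q \<alpha>0 \<beta>0 n) / of_int (jp_r \<alpha>0 \<beta>0 n) - \<beta>0\<bar>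
                    < c powi (- int N) / of_int (jp_r \<alpha>0 \<beta>0 n) powr (1 + a))))"
proof (intro conjI impI)
  interpret jacobi_perron \<alpha>0 \<beta>0
    using assms by unfold_locales (auto intro: jp_independent_imp_int_independent)
  assume "limsup (\<lambda>n. ereal (al n / be n)) < 1 \<and> liminf (\<lambda>n. ereal (be n)) > 1"
  then obtain s t where s: "limsup (\<lambda>n. ereal (al n / be n)) < ereal s" "ereal s < 1"
    and t: "liminf (\<lambda>n. ereal (be n)) > ereal t" "ereal t > 1"
    using ereal_dense2 by meson
  have "\<forall>\<^sub>F n in sequentially. al n / be n < s"
    using Limsup_lessD[OF s(1)] by simp
  moreover have "\<forall>\<^sub>F n in sequentially. t < be n"
    using less_LiminfD[OF t(1)] by simp
  ultimately have ev: "\<forall>\<^sub>F n in sequentially. al n / be n < s \<and> t < be n"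
    by eventually_elim auto
  have st: "s < 1" "1 < t" using s t by auto
  define e where "e = min 1 (min (1 - s) (1 - 1 / t))"
  have e: "0 < e" "e \<le> 1" using st by (auto simp: e_def)
  have "\<forall>\<^sub>F n in sequentially. frac (al n) \<le> 1 - e \<and> frac (be n) \<le> 1 - e"
    using eventually_compose_filterlim[OF ev filterlim_Suc]
  proof eventually_elim
    case (elim n)
    then have "1 / be (Suc n) \<le> 1 / t" using st by (intro divide_left_mono) auto
    with elim show ?case unfolding frac_al_eq frac_be_eq by (auto simp: e_def)
  qed
  from Delta_decay[OF e this] obtain c N where cN: "0 < c" "c < 1"
    "\<And>n. \<bar>jp_Delta \<alpha>0 \<beta>0 n\<bar> < frac \<alpha>0 * (c ^ n / c ^ N)"
    "\<And>n. \<bar>jp_Delta' \<alpha>0 \<beta>0 n\<bar> < c ^ n / c ^ N" by metis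
  moreover have "c ^ n / c ^ N = c ^ (n - N)" if "n \<ge> N + 3" for n
    using that cN(1) by (simp add: power_diff)
  ultimately show "\<exists>c N. 0 < c \<and> c < 1 \<and>
      (\<forall>n\<ge>N + 3. \<bar>jp_Delta \<alpha>0 \<beta>0 n\<bar> < frac \<alpha>0 * c ^ (n - N) \<and>
        \<bar>jp_Delta' \<alpha>0 \<beta>0 n\<bar> < c ^ (n - N))"
    by metis
next
  interpret jacobi_perron \<alpha>0 \<beta>0
    using assms by unfold_locales (auto intro: jp_independent_imp_int_independent)
  assume "bdd_above (range be)"
  then obtain B where B: "\<And>n. be n \<le> B" by (auto simp: bdd_above_def)
  have B1: "1 \<le> B" using B[of 0] be_ge_1[of 0] by linarith
  then have "0 < 1 / B ^ 3" "1 / B ^ 3 \<le> 1" by auto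
  from Delta_decay[OF this always_eventually] bounded_frac_gap[OF B]
  obtain c N where cN: "0 < c" "c < 1"
    "\<And>n. \<bar>jp_Delta \<alpha>0 \<beta>0 n\<bar> < frac \<alpha>0 * (c ^ n / c ^ N)"
    "\<And>n. \<bar>jp_Delta' \<alpha>0 \<beta>0 n\<bar> < c ^ n / c ^ N" by metis
  define K where "K = 2 * B + 1"
  have K: "1 < K" using B1 by (simp add: K_def)
  (* K powr a = 1 / c, so the a-th power of r grows at most as fast as the errors decay. *)
  define a where "a = log K (1 / c)"
  have a: "0 < a" using K cN by (simp add: a_def)
  have powr_a: "of_int (jp_r \<alpha>0 \<beta>0 n) powr a \<le> 1 / c ^ n" for n
  proof -
    have "of_int (jp_r \<alpha>0 \<beta>0 n) powr a \<le> (K ^ n) powr a"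
      using r_growth[OF B, of n] r_ge_1[of n] a unfolding K_def by (intro powr_mono2) auto
    also have "\<dots> = (K powr a) ^ n"
      using K by (simp add: powr_powr powr_realpow[symmetric] mult.commute)
    also have "\<dots> = 1 / c ^ n"
      using K cN by (simp add: a_def power_one_over)
    finally show ?thesis .
  qed
  have quotient: "\<bar>of_int p / of_int (jp_r \<alpha>0 \<beta>0 n) - z\<bar>
      < f * c powi (- int N) / of_int (jp_r \<alpha>0 \<beta>0 n) powr (1 + a)"
    if err: "\<bar>of_int p - z * of_int (jp_r \<alpha>0 \<beta>0 n)\<bar> < f * (c ^ n / c ^ N)" for p z f n
  proof -
    define r where "r = real_of_int (jp_r \<alpha>0 \<beta>0 n)"
    have r: "0 < r" using r_ge_1[of n] by (simp add: r_def)
    have "\<bar>of_int p - z * r\<bar> * r powr a \<le> \<bar>of_int p - z * r\<bar> * (1 / c ^ n)"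
      using powr_a[of n] unfolding r_def by (intro mult_left_mono) auto
    also have "\<dots> < f * (c ^ n / c ^ N) * (1 / c ^ n)"
      using err cN unfolding r_def by (intro mult_strict_right_mono) auto
    also have "\<dots> = f * c powi (- int N)"
      using cN by (simp add: power_int_minus field_simps)
    finally have "\<bar>of_int p - z * r\<bar> < f * c powi (- int N) / r powr a"
      using r by (simp add: field_simps)
    then have "\<bar>of_int p - z * r\<bar> / r < f * c powi (- int N) / r powr a / r"
      using r by (intro divide_strict_right_mono) auto
    moreover have "of_int p / r - z = (of_int p - z * r) / r" using r by (simp add: field_simps)
    moreover have "r powr (1 + a) = r powr a * r" using r by (simp add: powr_add)
    ultimately show ?thesis using r unfolding r_def[symmetric] by simp
  qed
  have "c ^ n / c ^ N = c ^ (n - N)" if "n \<ge> N + 3" for n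
    using that cN(1) by (simp add: power_diff)
  then have "\<forall>n\<ge>N + 3. \<bar>jp_Delta \<alpha>0 \<beta>0 n\<bar> < frac \<alpha>0 * c ^ (n - N) \<and>
      \<bar>jp_Delta' \<alpha>0 \<beta>0 n\<bar> < c ^ (n - N)"
    using cN(3,4) by metis
  moreover have "\<bar>of_int (jp_p \<alpha>0 \<beta>0 n) / of_int (jp_r \<alpha>0 \<beta>0 n) - \<alpha>0\<bar>
        < frac \<alpha>0 * c powi (- int N) / of_int (jp_r \<alpha>0 \<beta>0 n) powr (1 + a)" for n
    using cN(3)[of n] unfolding jp_Delta_def by (rule quotient)
  moreover have "\<bar>of_int (jp_q \<alpha>0 \<beta>0 n) / of_int (jp_r \<alpha>0 \<beta>0 n) - \<beta>0\<bar>
        < c powi (- int N) / of_int (jp_r \<alpha>0 \<beta>0 n) powr (1 + a)" for n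
    using cN(4)[of n] quotient[of "jp_q \<alpha>0 \<beta>0 n" \<beta>0 n 1] unfolding jp_Delta'_def by simp
  ultimately show "\<exists>c N a. 0 < c \<and> c < 1 \<and> 0 < a \<and>
      (\<forall>n\<ge>N + 3. \<bar>jp_Delta \<alpha>0 \<beta>0 n\<bar> < frac \<alpha>0 * c ^ (n - N) \<and>
        \<bar>jp_Delta' \<alpha>0 \<beta>0 n\<bar> < c ^ (n - N)) \<and>
      (\<forall>n\<ge>3. \<bar>of_int (jp_p \<alpha>0 \<beta>0 n) / of_int (jp_r \<alpha>0 \<beta>0 n) - \<alpha>0\<bar>
          < frac \<alpha>0 * c powi (- int N) / of_int (jp_r \<alpha>0 \<beta>0 n) powr (1 + a) \<and>
        \<bar>of_int (jp_q \<alpha>0 \<beta>0 n) / of_int (jp_r \<alpha>0 \<beta>0 n) - \<beta>0\<bar>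
          < c powi (- int N) / of_int (jp_r \<alpha>0 \<beta>0 n) powr (1 + a))"
    using cN(1,2) a by blast
qed

end
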